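(* For every integer $n>24\,p_1p_2\cdots p_{16}=782139803452561073520$, $$\tau(n)\le \left(\frac{2\log n}{\omega(n)\log_+ \omega(n)}\right)^{\omega(n)}.$$ Moreover, this inequality also holds for every integer $n\ge 2$ with $\omega(n)\le 3$.
   Context: $\tau(n)$ denotes the number of positive divisors of $n$, $\omega(n)$ the number of distinct prime factors of $n$, $\log_+ x:=\log\max(2,x)$, and $p_i$ denotes the $i$-th prime ($p_1=2$). *)

theory Defs
  imports Complex_Main "HOL-Computational_Algebra.Primes" "HOL-Library.Infinite_Set"
begin

definition num_divisors :: "nat \<Rightarrow> nat" where
  "num_divisors n = card {d. d dvd n}"

definition omega :: "nat \<Rightarrow> nat" where
  "omega n = card (prime_factors n)"

definition log_plus :: "real \<Rightarrow> real" where
  "log_plus x = ln (max 2 x)"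

text \<open>Indexed from 1, so that \<open>nth_prime 1 = 2\<close>; the value at index 0 is irrelevant
  (it is also 2, by truncated subtraction).\<close>

definition nth_prime :: "nat \<Rightarrow> nat" where
  "nth_prime i = enumerate {p. prime p} (i - 1)"

end

theory Submission
  imports Defs "HOL-Analysis.Complex_Transcendental" "HOL-Analysis.Harmonic_Numbers"
begin

text \<open>
  Split off the exact power \<open>q ^ a\<close> of the largest prime factor of \<open>n = q ^ a * m\<close> and put
  \<open>k = omega m\<close>. By the weighted AM-GM inequality the bound passes from \<open>m\<close> to \<open>n\<close> as soon as
  \<open>ln q \<ge> ln (k + 1) ^ (k + 1) / ln k ^ k\<close>. For \<open>k \<ge> 17\<close> this only requires that the \<open>k\<close>-th prime is at
  least \<open>c * k\<close> with \<open>c\<close> slightly above \<open>e\<close>, and sieving by 2, 3 and 5 gives 15/4 asymptotically. It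
  remains to treat \<open>k = omega n \<le> 17\<close>.

  AM-GM applied to the numbers \<open>(a + 1) * ln p\<close> gives
  \<open>num_divisors n * (\<Prod>i\<le>k. ln p\<^sub>i) \<le> ((ln n + ln (p\<^sub>1 \<cdots> p\<^sub>k)) / k) ^ k\<close>, which suffices for \<open>k \<le> 14\<close> and,
  for \<open>15 \<le> k \<le> 17\<close>, when \<open>n\<close> is large. For the remaining \<open>n\<close> put \<open>n = t * r\<close> with \<open>r\<close> the radical
  of \<open>n\<close>. Then \<open>num_divisors n / 2 ^ k\<close> depends on \<open>t\<close> only; it is bounded by a supporting power
  \<open>15/4 * (t / 24) powr (4/15)\<close> when \<open>t \<ge> 48\<close>, and by inspection when \<open>t < 48\<close>.
\<close>

section \<open>Primes and divisors\<close>

lemma prime_nth_prime: "prime (nth_prime i)"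
  using enumerate_in_set[OF primes_infinite, of "i - 1"] by (simp add: nth_prime_def)

lemma nth_prime_mono: "i \<le> j \<Longrightarrow> nth_prime i \<le> nth_prime j"
  by (simp add: nth_prime_def primes_infinite)

lemma nth_prime_strict_mono: "0 < i \<Longrightarrow> i < j \<Longrightarrow> nth_prime i < nth_prime j"
  by (simp add: nth_prime_def primes_infinite)

lemma nth_prime_le_of_card:
  assumes "prime q" and "finite S" and "\<And>p. p \<in> S \<Longrightarrow> prime p \<and> p < q"
  shows "nth_prime (Suc (card S)) \<le> q"
proof -
  let ?E = "enumerate {p::nat. prime p}"
  obtain j where j: "?E j = q"
    using enumerate_Ex[OF primes_infinite, of q] assms(1) by auto
  have "S \<subseteq> ?E ` {..<j}"
  proof
    fix p assume "p \<in> S"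
    with assms(3) have p: "prime p" "p < q" by auto
    obtain i where i: "?E i = p"
      using enumerate_Ex[OF primes_infinite, of p] p by auto
    with j p have "i < j" using primes_infinite by (metis enumerate_mono_iff)
    with i show "p \<in> ?E ` {..<j}" by auto
  qed
  then have "card S \<le> j"
    by (metis card_image_le card_lessThan card_mono finite_imageI finite_lessThan le_trans)
  with j show ?thesis by (auto simp: nth_prime_def primes_infinite)
qed

text \<open>The gap is given as a list, so that the simplifier decides the primality of each entry,
  and \<open>j = Suc i\<close> is a premise, so that numerals match.\<close>

lemma nth_prime_Suc_eqI:
  assumes "nth_prime i = p" "i > 0" "j = Suc i" "prime q" "p < q"
    and "\<forall>x\<in>set [Suc p..<q]. \<not> prime x"
  shows "nth_prime j = q"
proof -
  have "enumerate {p::nat. prime p} (Suc (i - 1)) = q"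
    unfolding enumerate_Suc''[OF primes_infinite]
  proof (rule Least_equality)
    fix y assume "y \<in> {p::nat. prime p} \<and> enumerate {p. prime p} (i - 1) < y"
    then have "prime y" "p < y" using assms(1) by (auto simp: nth_prime_def)
    with assms(6) show "q \<le> y" by (metis Suc_leI atLeastLessThan_iff linorder_not_less set_upt)
  qed (use assms in \<open>auto simp: nth_prime_def\<close>)
  with assms(2,3) show ?thesis by (simp add: nth_prime_def)
qed

lemma nth_prime_1: "nth_prime 1 = 2"
  unfolding nth_prime_def by (simp add: enumerate_0) (rule Least_equality, auto dest: prime_ge_2_nat)

lemma nth_prime_2: "nth_prime 2 = 3" by (rule nth_prime_Suc_eqI[OF nth_prime_1]) simp_all
lemma nth_prime_3: "nth_prime 3 = 5" by (rule nth_prime_Suc_eqI[OF nth_prime_2]) simp_all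
lemma nth_prime_4: "nth_prime 4 = 7" by (rule nth_prime_Suc_eqI[OF nth_prime_3]) simp_all
lemma nth_prime_5: "nth_prime 5 = 11" by (rule nth_prime_Suc_eqI[OF nth_prime_4]) simp_all
lemma nth_prime_6: "nth_prime 6 = 13" by (rule nth_prime_Suc_eqI[OF nth_prime_5]) simp_all
lemma nth_prime_7: "nth_prime 7 = 17" by (rule nth_prime_Suc_eqI[OF nth_prime_6]) simp_all
lemma nth_prime_8: "nth_prime 8 = 19" by (rule nth_prime_Suc_eqI[OF nth_prime_7]) simp_all
lemma nth_prime_9: "nth_prime 9 = 23" by (rule nth_prime_Suc_eqI[OF nth_prime_8]) simp_all
lemma nth_prime_10: "nth_prime 10 = 29" by (rule nth_prime_Suc_eqI[OF nth_prime_9]) simp_all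
lemma nth_prime_11: "nth_prime 11 = 31" by (rule nth_prime_Suc_eqI[OF nth_prime_10]) simp_all
lemma nth_prime_12: "nth_prime 12 = 37" by (rule nth_prime_Suc_eqI[OF nth_prime_11]) simp_all
lemma nth_prime_13: "nth_prime 13 = 41" by (rule nth_prime_Suc_eqI[OF nth_prime_12]) simp_all
lemma nth_prime_14: "nth_prime 14 = 43" by (rule nth_prime_Suc_eqI[OF nth_prime_13]) simp_all
lemma nth_prime_15: "nth_prime 15 = 47" by (rule nth_prime_Suc_eqI[OF nth_prime_14]) simp_all
lemma nth_prime_16: "nth_prime 16 = 53" by (rule nth_prime_Suc_eqI[OF nth_prime_15]) simp_all
lemma nth_prime_17: "nth_prime 17 = 59" by (rule nth_prime_Suc_eqI[OF nth_prime_16]) simp_all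
lemma nth_prime_18: "nth_prime 18 = 61" by (rule nth_prime_Suc_eqI[OF nth_prime_17]) simp_all
lemma nth_prime_19: "nth_prime 19 = 67" by (rule nth_prime_Suc_eqI[OF nth_prime_18]) simp_all
lemma nth_prime_20: "nth_prime 20 = 71" by (rule nth_prime_Suc_eqI[OF nth_prime_19]) simp_all
lemma nth_prime_21: "nth_prime 21 = 73" by (rule nth_prime_Suc_eqI[OF nth_prime_20]) simp_all
lemma nth_prime_22: "nth_prime 22 = 79" by (rule nth_prime_Suc_eqI[OF nth_prime_21]) simp_all
lemma nth_prime_23: "nth_prime 23 = 83" by (rule nth_prime_Suc_eqI[OF nth_prime_22]) simp_all
lemma nth_prime_24: "nth_prime 24 = 89" by (rule nth_prime_Suc_eqI[OF nth_prime_23]) simp_all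
lemma nth_prime_25: "nth_prime 25 = 97" by (rule nth_prime_Suc_eqI[OF nth_prime_24]) simp_all

lemmas nth_prime_values =
  nth_prime_1 nth_prime_2 nth_prime_3 nth_prime_4 nth_prime_5 nth_prime_6 nth_prime_7
  nth_prime_8 nth_prime_9 nth_prime_10 nth_prime_11 nth_prime_12 nth_prime_13 nth_prime_14
  nth_prime_15 nth_prime_16 nth_prime_17 nth_prime_18 nth_prime_19 nth_prime_20 nth_prime_21
  nth_prime_22 nth_prime_23 nth_prime_24 nth_prime_25

text \<open>Primes from 7 on lie in the 8 residue classes coprime to 30, so among 9 consecutive ones
  two are congruent and differ by at least 30.\<close>

lemma nth_prime_add_8:
  assumes "i \<ge> 4"
  shows "nth_prime i + 30 \<le> nth_prime (i + 8)"
proof (rule ccontr)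
  let ?p = "nth_prime i" and ?R = "{1,7,11,13,17,19,23,29::nat}"
  assume "\<not> ?thesis"
  then have less: "nth_prime (i + 8) < ?p + 30" by simp
  have p7: "7 \<le> ?p" using nth_prime_mono[OF assms] by (simp add: nth_prime_values)
  let ?X = "nth_prime ` {i..i + 8}"
  have inj: "inj_on nth_prime {i..i + 8}"
    using assms nth_prime_strict_mono
    by (intro linorder_inj_onI') (auto simp: less_imp_neq)
  have bnd: "?p \<le> x \<and> x < ?p + 30 \<and> prime x" if x: "x \<in> ?X" for x
  proof -
    obtain j where "x = nth_prime j" "i \<le> j" "j \<le> i + 8"
      using x by auto
    then show ?thesis using less nth_prime_mono[of i j] nth_prime_mono[of j "i + 8"] prime_nth_prime[of j]
      by simp
  qed
  have "inj_on (\<lambda>x. x mod 30) ?X"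
  proof (rule inj_onI)
    fix x y assume "x \<in> ?X" "y \<in> ?X" and eq: "x mod 30 = y mod 30"
    then have "x < y + 30" "y < x + 30" using bnd[of x] bnd[of y] by linarith+
    with eq div_mult_mod_eq[of x 30] div_mult_mod_eq[of y 30] have "x div 30 = y div 30"
      by linarith
    with eq show "x = y" by (metis div_mult_mod_eq)
  qed
  moreover have "(\<lambda>x. x mod 30) ` ?X \<subseteq> ?R"
  proof (rule image_subsetI)
    fix y assume "y \<in> ?X"
    then have x: "prime (y)" "y \<ge> 7" using bnd[of y] p7 by auto
    have nd: "\<not> d dvd y" if "d \<in> {2,3,5}" for d
      using that x by (auto simp: prime_nat_iff)
    have "\<not> 2 dvd y" "\<not> 3 dvd y" "\<not> 5 dvd y"
      using nd by auto
    moreover define r where "r = y mod 30"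
    moreover have "d dvd y \<longleftrightarrow> d dvd r" if "d dvd 30" for d
      using that by (simp add: r_def dvd_mod_iff)
    moreover have "r < 30" by (simp add: r_def)
    ultimately have "\<not> 2 dvd r" "\<not> 3 dvd r" "\<not> 5 dvd r" "r < 30" by auto
    moreover from \<open>r < 30\<close> have "r \<in> set (0 # 1 # [2..<30])"
      by (simp only: list.set insert_iff set_upt atLeastLessThan_iff) arith
    moreover have "\<forall>r\<in>set (0 # 1 # [2..<30]). \<not> 2 dvd r \<and> \<not> 3 dvd r \<and> \<not> 5 dvd r \<longrightarrow> r \<in> ?R"
      by simp
    ultimately show "y mod 30 \<in> ?R" unfolding r_def by blast
  qed
  ultimately have "card ?X \<le> card ?R" by (rule card_inj_on_le) simp
  with inj show False by (simp add: card_image)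
qed

text \<open>Induction in steps of 8, since 15 * 8 = 4 * 30. The base cases are i = 18, ..., 25; the
  constant 26 comes from i = 18, where 15 * 18 = 4 * 61 + 26.\<close>

lemma nth_prime_lower_bound:
  assumes "i \<ge> 18"
  shows "15 * i \<le> 4 * nth_prime i + 26"
  using assms
proof (induction i rule: less_induct)
  case (less i)
  show ?case
  proof (cases "i < 26")
    case True
    with less.prems have "i \<in> set [18..<26]" by (simp only: set_upt atLeastLessThan_iff)
    moreover have "\<forall>i\<in>set [18..<26]. 15 * i \<le> 4 * nth_prime i + 26"
      by (simp add: nth_prime_values)
    ultimately show ?thesis by blast
  next
    case False
    define j where "j = i - 8"
    have j: "i = j + 8" "j \<ge> 18" using False by (auto simp: j_def)
    with less.IH[of j] nth_prime_add_8[of j] show ?thesis by simp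
  qed
qed

section \<open>Divisor counts and induction over the largest prime factor\<close>

lemma num_divisors_prime_power_mult:
  assumes "prime q" "\<not> q dvd m" 
  shows "num_divisors (q ^ a * m) = Suc a * num_divisors m"
proof -
  let ?f = "\<lambda>(i, e). q ^ i * e"
  have cop: "coprime (q ^ i) e" if "e dvd m" for i e
    using that assms by (meson coprime_power_left_iff dvd_trans prime_imp_coprime)
  have "bij_betw ?f ({..a} \<times> {e. e dvd m}) {d. d dvd q ^ a * m}"
  proof (rule bij_betw_imageI)
    show "inj_on ?f ({..a} \<times> {e. e dvd m})"
    proof (rule inj_onI, clarsimp)
      fix i e j e' assume *: "e dvd m" "e' dvd m" "q ^ i * e = q ^ j * e'"
      have "q ^ i dvd q ^ j" "q ^ j dvd q ^ i"
        using cop[OF *(1)] cop[OF *(2)] *(3) by (metis coprime_dvd_mult_left_iff dvd_triv_left)+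
      then have "q ^ i = q ^ j" by (rule dvd_antisym)
      moreover from this have "i = j"
        using prime_gt_1_nat[OF assms(1)] by (simp add: power_inject_exp)
      ultimately show "i = j \<and> e = e'" using *(3) assms(1) by auto
    qed
    show "?f ` ({..a} \<times> {e. e dvd m}) = {d. d dvd q ^ a * m}"
    proof (intro equalityI subsetI)
      fix d assume "d \<in> {d. d dvd q ^ a * m}"
      then obtain b c where "d = b * c" "b dvd q ^ a" "c dvd m"
        using division_decomp[of d "q ^ a" m] by auto
      then show "d \<in> ?f ` ({..a} \<times> {e. e dvd m})"
        using divides_primepow_nat[OF assms(1)] by force
    qed (auto intro: mult_dvd_mono le_imp_power_dvd)
  qed
  then show ?thesis
    unfolding num_divisors_def by (simp flip: bij_betw_same_card add: card_cartesian_product)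
qed

lemma prime_factors_prime_power_mult:
  assumes "prime (q::nat)" "a > 0" "m > 0"
  shows "prime_factors (q ^ a * m) = insert q (prime_factors m)"
  using assms by (simp add: prime_factorization_mult prime_factorization_prime_power)

lemma omega_prime_power_mult:
  assumes "prime q" "\<not> q dvd m" "a > 0" "m > 0"
  shows "omega (q ^ a * m) = Suc (omega m)"
  using assms by (simp add: omega_def prime_factors_prime_power_mult) (auto simp: in_prime_factors_iff)

text \<open>The removed prime q exceeds all \<open>omega m\<close> prime factors of the cofactor m;
  hence the lower bound for q in the induction step.\<close>

lemma largest_prime_induct [consumes 1, case_names one prime_power]:
  fixes n :: nat
  assumes "n > 0" and one: "P 1"
    and step: "\<And>q a m. prime q \<Longrightarrow> \<not> q dvd m \<Longrightarrow> a > 0 \<Longrightarrow> m > 0 \<Longrightarrow>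
      nth_prime (Suc (omega m)) \<le> q \<Longrightarrow> P m \<Longrightarrow> P (q ^ a * m)"
  shows "P n"
  using assms(1)
proof (induction n rule: less_induct)
  case (less n)
  show ?case
  proof (cases "n = 1")
    case False
    with less.prems have ne: "prime_factors n \<noteq> {}"
      by (simp add: prime_factorization_empty_iff)
    define q where "q = Max (prime_factors n)"
    have q: "q \<in> prime_factors n" using ne by (simp add: q_def)
    then have pq: "prime q" "q dvd n" by auto
    obtain m where m: "n = q ^ multiplicity q n * m" "\<not> q dvd m"
      using multiplicity_decompose'[of n q] less.prems pq not_prime_unit[of q] by blast
    define a where "a = multiplicity q n"
    have a: "a > 0" using pq less.prems by (simp add: a_def prime_multiplicity_gt_zero_iff)
    have m0: "m > 0" using m less.prems by (cases m) auto
    have n: "n = q ^ a * m" unfolding a_def by (rule m(1))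
    have "q ^ a > 1" by (rule one_less_power[OF prime_gt_1_nat[OF pq(1)] a])
    then have "m < n" using m0 by (subst n) simp
    have "p < q" if "p \<in> prime_factors m" for p
    proof -
      have "p \<in> prime_factors n"
        unfolding n prime_factors_prime_power_mult[OF pq(1) a m0] using that by simp
      then have "p \<le> q" by (simp add: q_def)
      moreover have "p \<noteq> q" using that m(2) by auto
      ultimately show ?thesis by simp
    qed
    then have "nth_prime (Suc (omega m)) \<le> q"
      unfolding omega_def by (intro nth_prime_le_of_card pq) auto
    with step[OF pq(1) m(2) a m0] less.IH[OF \<open>m < n\<close> m0] n show ?thesis by simp
  qed (use one in simp)
qed

section \<open>Primorials and the AM-GM bound for the number of divisors\<close>

definition primorial :: "nat \<Rightarrow> nat" where
  "primorial k = (\<Prod>i=1..k. nth_prime i)"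

lemma primorial_0 [simp]: "primorial 0 = 1"
  by (simp add: primorial_def)

lemma primorial_Suc: "primorial (Suc k) = primorial k * nth_prime (Suc k)"
  by (simp add: primorial_def)

lemma primorial_pos: "primorial k > 0"
  by (auto simp: primorial_def intro!: prod_pos prime_gt_0_nat prime_nth_prime)

lemma num_divisors_1: "num_divisors 1 = 1"
  by (simp add: num_divisors_def)

lemma omega_1: "omega 1 = 0"
  by (simp add: omega_def)

lemma ln_prime_power_mult:
  assumes "prime q" "m > (0::nat)"
  shows "ln (real (q ^ a * m)) = real a * ln (real q) + ln (real m)"
  using assms by (simp add: ln_mult ln_realpow prime_gt_0_nat)

text \<open>AM-GM for k copies of L / k and one l. Bernoulli's inequality is applied to u, the
  quotient of the new mean by the old mean g; the case distinction ensures that g is not 0.\<close>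

lemma weighted_am_gm:
  fixes L l :: real
  assumes "L \<ge> 0" "l \<ge> 0"
  shows "(L / real k) ^ k * l \<le> ((L + l) / real (Suc k)) ^ Suc k"
proof (cases "k = 0 \<or> L = 0")
  case True
  then show ?thesis using assms by (cases k) auto
next
  case False
  define g where "g = L / real k"
  define u where "u = (L + l) / (real (Suc k) * g)"
  have g: "g > 0" using False assms by (simp add: g_def)
  have L: "L = real k * g" using False by (simp add: g_def)
  have u: "(L + l) / real (Suc k) = g * u" using g by (simp add: u_def)
  have "u \<ge> 0" using assms g by (simp add: u_def)
  then have "1 + real (Suc k) * (u - 1) \<le> (1 + (u - 1)) ^ Suc k"
    by (intro Bernoulli_inequality) simp
  then have "real (Suc k) * u - real k \<le> u ^ Suc k" by (simp add: algebra_simps)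
  moreover have "l = g * (real (Suc k) * u - real k)"
    using u L by (simp add: field_simps)
  ultimately have "l \<le> g * u ^ Suc k" using g by simp
  then have "g ^ k * l \<le> g ^ k * (g * u ^ Suc k)" using g by (intro mult_left_mono) auto
  also have "\<dots> = ((L + l) / real (Suc k)) ^ Suc k" by (simp only: u power_mult_distrib power_Suc mult_ac)
  finally show ?thesis by (simp add: g_def)
qed

lemma radical_prime_power_mult:
  assumes "prime q" "\<not> q dvd m" "a > 0" "m > (0::nat)"
  shows "\<Prod>(prime_factors (q ^ a * m)) = q * \<Prod>(prime_factors m)"
proof -
  have "q \<notin> prime_factors m" using assms by auto
  then show ?thesis unfolding prime_factors_prime_power_mult[OF assms(1,3,4)] by simp
qed

text \<open>The i-th smallest element of S is at least the i-th prime, so the elements are added in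
  increasing order.\<close>

lemma primorial_le_prod_primes:
  assumes "finite S" "\<And>p. p \<in> S \<Longrightarrow> prime p"
  shows "primorial (card S) \<le> \<Prod>S"
  using assms
proof (induction S rule: finite_linorder_max_induct)
  case (insert q S)
  have "nth_prime (Suc (card S)) \<le> q"
    using insert by (intro nth_prime_le_of_card) auto
  with insert have "primorial (card S) * nth_prime (Suc (card S)) \<le> \<Prod>S * q"
    by (intro mult_le_mono) auto
  moreover have "q \<notin> S" using insert by auto
  ultimately show ?case using insert by (simp add: primorial_Suc mult.commute)
qed simp

lemma primorial_le_radical: "primorial (omega n) \<le> \<Prod>(prime_factors n)"
  unfolding omega_def by (intro primorial_le_prod_primes) auto

lemma num_divisors_am_gm:
  assumes "n > 0"
  shows "real (num_divisors n) * (\<Prod>i=1..omega n. ln (real (nth_prime i)))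
    \<le> ((ln (real n) + ln (real (primorial (omega n)))) / real (omega n)) ^ omega n"
  using assms
proof (induction n rule: largest_prime_induct)
  case one
  show ?case by (simp add: num_divisors_1[simplified] omega_1[simplified])
next
  case (prime_power q a m)
  let ?k = "omega m" and ?p = "nth_prime (Suc (omega m))"
  let ?L = "ln (real m) + ln (real (primorial ?k))"
  let ?l = "real a * ln (real q) + ln (real ?p)"
  have p2: "?p \<ge> 2" using prime_nth_prime by (rule prime_ge_2_nat)
  have pq: "ln (real ?p) \<le> ln (real q)" using prime_power p2 by simp
  have lp: "ln (real ?p) > 0" using p2 by simp
  have L: "?L \<ge> 0" using prime_power primorial_pos[of ?k] by simp
  have l: "?l \<ge> 0" using prime_power lp prime_gt_0_nat[of q] by (simp add: Suc_le_eq)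
  \<comment> \<open>The product contains the logarithm of the next prime p in place of ln q, and p
    <= q. Summed up, the right sides give ln n plus the logarithm of the primorial.\<close>
  have "real (Suc a) * ln (real ?p) \<le> ?l"
    using pq mult_left_mono[of "ln (real ?p)" "ln (real q)" "real a"] by (simp add: algebra_simps)
  then have "(real (num_divisors m) * (\<Prod>i=1..?k. ln (real (nth_prime i)))) * (real (Suc a) * ln (real ?p))
      \<le> (?L / real ?k) ^ ?k * ?l"
    using prime_power.IH L l lp
    by (intro mult_mono mult_nonneg_nonneg zero_le_power divide_nonneg_nonneg) auto
  also have "\<dots> \<le> ((?L + ?l) / real (Suc ?k)) ^ Suc ?k" by (rule weighted_am_gm[OF L l])
  also have "?L + ?l = ln (real (q ^ a * m)) + ln (real (primorial (Suc ?k)))"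
  proof -
    have "ln (real (primorial (Suc ?k))) = ln (real (primorial ?k)) + ln (real ?p)"
      using p2 primorial_pos[of ?k] by (simp add: primorial_Suc ln_mult)
    then show ?thesis unfolding ln_prime_power_mult[OF prime_power(1,4)] by simp
  qed
  also have "real (num_divisors m) * (\<Prod>i=1..?k. ln (real (nth_prime i))) * (real (Suc a) * ln (real ?p))
      = real (num_divisors (q ^ a * m)) * (\<Prod>i=1..Suc ?k. ln (real (nth_prime i)))"
    unfolding num_divisors_prime_power_mult[OF prime_power(1,2)] by (simp add: algebra_simps)
  finally show ?case unfolding omega_prime_power_mult[OF prime_power(1-4)] .
qed

section \<open>Exponents in excess of the radical\<close>

lemma Suc_div_2_le_power: "a > 0 \<Longrightarrow> real (Suc a) / 2 \<le> (3 / 2) ^ (a - 1)"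
  using Bernoulli_inequality[of "1/2::real" "a - 1"] by (cases a) auto

text \<open>Each prime above 3 contributes to \<open>num_divisors n / 2 ^ omega n\<close> at most a factor 3/2 per
  excess power, which is what the prime 5 contributes; hence the \<open>s\<close> fictitious powers of 5.\<close>

lemma num_divisors_excess:
  assumes "n > 0"
  defines "A \<equiv> multiplicity 2 n - 1" and "B \<equiv> multiplicity 3 n - 1"
  obtains s u where "n = 2 ^ A * 3 ^ B * u * \<Prod>(prime_factors n)" "5 ^ s \<le> u" "s = 0 \<longrightarrow> u = 1"
    "real (num_divisors n) \<le> 2 ^ omega n * ((real A + 2) / 2 * ((real B + 2) / 2) * (3 / 2) ^ s)"
proof -
  let ?P = "\<lambda>n s u. n = 2 ^ (multiplicity 2 n - 1) * 3 ^ (multiplicity 3 n - 1) * u * \<Prod>(prime_factors n)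
    \<and> 5 ^ s \<le> u \<and> (s = 0 \<longrightarrow> u = 1)
    \<and> real (num_divisors n) \<le> 2 ^ omega n * ((real (multiplicity 2 n - 1) + 2) / 2
      * ((real (multiplicity 3 n - 1) + 2) / 2) * (3 / 2) ^ s)"
  have "\<exists>s u. ?P n s u" using assms(1)
  proof (induction n rule: largest_prime_induct)
    case one
    have "?P 1 0 1" by (simp add: num_divisors_1[simplified] omega_1[simplified])
    then show ?case by (intro exI)
  next
    case (prime_power q a m)
    from prime_power.IH obtain s u where IH: "?P m s u" by (elim exE)
    have mult: "multiplicity p (q ^ a * m) = (if p = q then a else multiplicity p m)" if "prime p" for p
      using that prime_power
      by (auto simp: prime_elem_multiplicity_mult_distrib multiplicity_distinct_prime_power
          not_dvd_imp_multiplicity_0)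
    have m0: "multiplicity q m = 0" using prime_power by (simp add: not_dvd_imp_multiplicity_0)
    have rad: "\<Prod>(prime_factors (q ^ a * m)) = q * \<Prod>(prime_factors m)"
      using prime_power by (intro radical_prime_power_mult)
    have a: "q ^ a = q ^ (a - 1) * q" using prime_power by (metis Suc_diff_1 power_Suc2)
    have om: "omega (q ^ a * m) = Suc (omega m)" and nd: "num_divisors (q ^ a * m) = Suc a * num_divisors m"
      using prime_power by (simp_all add: omega_prime_power_mult num_divisors_prime_power_mult)
    have a1: "real (a - 1) = real a - 1" using prime_power by (simp add: of_nat_diff)
    have p23: "prime (2::nat)" "prime (3::nat)" by simp_all
    define M2 where "M2 = multiplicity 2 m - 1"
    define M3 where "M3 = multiplicity 3 m - 1"
    define R where "R = \<Prod>(prime_factors m)"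
    define D where "D = real (num_divisors m)"
    have IHm: "m = 2 ^ M2 * 3 ^ M3 * u * R"
      and IHu: "5 ^ s \<le> u" "s = 0 \<longrightarrow> u = 1"
      and IHd: "D \<le> 2 ^ omega m * ((real M2 + 2) / 2 * ((real M3 + 2) / 2) * (3 / 2) ^ s)"
      using IH unfolding M2_def M3_def R_def D_def by blast+
    have n: "q ^ a * m = q ^ (a - 1) * q * (2 ^ M2 * 3 ^ M3 * u * R)"
      using arg_cong2[OF a IHm, of "(*)"] .
    have d: "real (Suc a) * D
        \<le> real (Suc a) * (2 ^ omega m * ((real M2 + 2) / 2 * ((real M3 + 2) / 2) * (3 / 2) ^ s))"
      using IHd by (rule mult_left_mono) simp
    \<comment> \<open>The cases q = 2, q = 3 and q >= 5 change only A, only B, and only s and u,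
      respectively; this reduces each of them to one identity and one estimate.\<close>
    have goalI: "?P (q ^ a * m) s' u'"
      if "q ^ a * m = 2 ^ A' * 3 ^ B' * u' * (q * R)" "5 ^ s' \<le> u'" "s' = 0 \<longrightarrow> u' = 1"
        "real (Suc a) * D \<le> 2 ^ Suc (omega m) * ((real A' + 2) / 2 * ((real B' + 2) / 2) * (3 / 2) ^ s')"
        "A' = (if q = 2 then a - 1 else M2)" "B' = (if q = 3 then a - 1 else M3)" for s' u' A' B'
    proof -
      have AB: "multiplicity 2 (q ^ a * m) - 1 = A'" "multiplicity 3 (q ^ a * m) - 1 = B'"
        using that(5,6) mult[OF p23(1)] mult[OF p23(2)] by (auto simp: M2_def M3_def)
      show ?thesis
        unfolding AB rad om nd of_nat_mult R_def[symmetric] D_def[symmetric] using that(1-4) by blast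
    qed
    consider "q = 2" | "q = 3" | "q \<ge> 5"
    proof -
      have "q \<noteq> 4" using prime_power by auto
      then show ?thesis using that prime_ge_2_nat[OF prime_power(1)] by linarith
    qed
    then show ?case
    proof cases
      case 1
      \<comment> \<open>As 2 does not divide m, its old factor is (0 + 2) / 2 = 1, and twice its new
        factor is (a - 1) + 2 = a + 1.\<close>
      have "M2 = 0" using m0 1 by (simp add: M2_def)
      then have "?P (q ^ a * m) s u"
        using IHu n d 1 a1 by (intro goalI[of "a - 1" M3]) (auto simp: field_simps)
      then show ?thesis by (intro exI)
    next
      case 2
      have "M3 = 0" using m0 2 by (simp add: M3_def)
      then have "?P (q ^ a * m) s u"
        using IHu n d 2 a1 by (intro goalI[of M2 "a - 1"]) (auto simp: field_simps)
      then show ?thesis by (intro exI)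
    next
      case 3
      have q5: "5 ^ (a - 1) \<le> q ^ (a - 1)" using 3 by (intro power_mono) auto
      \<comment> \<open>One factor 2 goes into the power of 2; what remains is 3/2 for each excess
        power of q, counted as a power of 5.\<close>
      have "real (Suc a) \<le> 2 * (3 / 2) ^ (a - 1)"
        using Suc_div_2_le_power[OF prime_power(3)] by simp
      then have "real (Suc a) * (2 ^ omega m * ((real M2 + 2) / 2 * ((real M3 + 2) / 2) * (3 / 2) ^ s))
          \<le> 2 * (3 / 2) ^ (a - 1) * (2 ^ omega m * ((real M2 + 2) / 2 * ((real M3 + 2) / 2) * (3 / 2) ^ s))"
        by (rule mult_right_mono) simp
      also have "\<dots> = 2 ^ Suc (omega m) * ((real M2 + 2) / 2 * ((real M3 + 2) / 2) * (3 / 2) ^ (s + (a - 1)))"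
        by (simp add: power_add)
      finally have d3: "real (Suc a) * D \<le> \<dots>" using d by linarith
      have "?P (q ^ a * m) (s + (a - 1)) (u * q ^ (a - 1))"
      proof (rule goalI[of M2 M3])
        show "5 ^ (s + (a - 1)) \<le> u * q ^ (a - 1)"
          unfolding power_add using IHu(1) q5 by (rule mult_le_mono)
      qed (use 3 n IHu d3 in auto)
      then show ?thesis by (intro exI)
    qed
  qed
  then obtain s u where "?P n s u" by (elim exE)
  then show ?thesis using that[of u s] unfolding A_def B_def by (elim conjE) simp
qed

text \<open>\<open>t\<close> is n divided by its radical, which is at least the primorial. The
  equality for s = 0 later identifies t = 24 in the critical case.\<close>

lemma excess_decomposition:
  assumes "n > 0"
  obtains t A B s where "n = t * \<Prod>(prime_factors n)" "t * primorial (omega n) \<le> n" "t \<ge> 1"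
    "2 ^ A * 3 ^ B * 5 ^ s \<le> t" "s = 0 \<longrightarrow> t = 2 ^ A * 3 ^ B"
    "real (num_divisors n) \<le> 2 ^ omega n * ((real A + 2) / 2 * ((real B + 2) / 2) * (3 / 2) ^ s)"
proof -
  define A where "A = multiplicity 2 n - 1"
  define B where "B = multiplicity 3 n - 1"
  obtain s u where u: "n = 2 ^ A * 3 ^ B * u * \<Prod>(prime_factors n)" "5 ^ s \<le> u" "s = 0 \<longrightarrow> u = 1"
    "real (num_divisors n) \<le> 2 ^ omega n * ((real A + 2) / 2 * ((real B + 2) / 2) * (3 / 2) ^ s)"
    by (rule num_divisors_excess[OF assms, folded A_def B_def], rule that)
  define t where "t = 2 ^ A * 3 ^ B * u"
  have n: "n = t * \<Prod>(prime_factors n)" using u(1) by (simp only: t_def)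
  have "t * primorial (omega n) \<le> t * \<Prod>(prime_factors n)"
    by (intro mult_le_mono2 primorial_le_radical)
  with n have "t * primorial (omega n) \<le> n" by simp
  moreover have "t \<noteq> 0" using n assms by (intro notI) simp
  then have "t \<ge> 1" by simp
  moreover have "2 ^ A * 3 ^ B * 5 ^ s \<le> t" unfolding t_def using u(2) by (rule mult_le_mono2)
  moreover have "s = 0 \<longrightarrow> t = 2 ^ A * 3 ^ B" using u(3) by (simp add: t_def)
  ultimately show ?thesis using that[OF n] u(4) by blast
qed

section \<open>Passing from \<open>k\<close> to \<open>k + 1\<close> prime factors\<close>

text \<open>For n = 1 the division by zero is harmless, as the exponent 0 makes the right side 1; so
  n = 1 can start an induction.\<close>

definition divisor_bound :: "nat \<Rightarrow> bool" where
  "divisor_bound n \<longleftrightarrow> real (num_divisors n) \<le>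
    (2 * ln (real n) / (real (omega n) * log_plus (real (omega n)))) ^ omega n"

lemma log_plus_ge_2: "x \<ge> 2 \<Longrightarrow> log_plus x = ln x"
  by (simp add: log_plus_def max_def)

lemma log_plus_pos: "log_plus x > 0"
  by (simp add: log_plus_def)

text \<open>\<open>a + 1 \<le> 2 * a\<close> supplies the additional factor 2, and weighted AM-GM
  absorbs the factor \<open>a * ln q\<close> into ln n. The condition on q compensates the change of
  the power of \<open>log_plus\<close> in the denominator.\<close>

lemma divisor_bound_prime_power_mult:
  assumes "divisor_bound m" "prime q" "\<not> q dvd m" "a > 0" "m > 0"
    and q: "log_plus (real (Suc (omega m))) ^ Suc (omega m) \<le> ln (real q) * log_plus (real (omega m)) ^ omega m"
  shows "divisor_bound (q ^ a * m)"
proof -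
  define k where "k = omega m"
  define L where "L = ln (real m)"
  define l where "l = real a * ln (real q)"
  define x where "x = log_plus (real k)"
  define y where "y = log_plus (real (Suc k))"
  have pos: "x > 0" "y > 0" by (simp_all add: x_def y_def log_plus_pos)
  have "L \<ge> 0" using assms by (simp add: L_def)
  have lq: "ln (real q) > 0" using prime_gt_1_nat[OF assms(2)] by simp
  then have "l \<ge> 0" by (simp add: l_def)
  have "real (num_divisors m) \<le> (2 * L / (real k * x)) ^ k"
    using assms(1) by (simp add: divisor_bound_def k_def L_def x_def)
  also have "\<dots> = 2 ^ k / x ^ k * (L / real k) ^ k"
    by (simp add: power_mult_distrib power_divide)
  finally have 1: "real (num_divisors m) \<le> 2 ^ k / x ^ k * (L / real k) ^ k" .
  have a2: "real (Suc a) \<le> 2 * real a" using assms by simp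
  have "real (Suc a) * y ^ Suc k \<le> 2 * real a * (ln (real q) * x ^ k)"
    using a2 q pos lq by (intro mult_mono) (auto simp: k_def x_def y_def)
  then have 2: "real (Suc a) / x ^ k \<le> 2 * l / y ^ Suc k"
    using pos by (simp add: l_def field_simps)
  have "real (Suc a) * real (num_divisors m) \<le> real (Suc a) * (2 ^ k / x ^ k * (L / real k) ^ k)"
    using 1 by (rule mult_left_mono) simp
  also have "\<dots> = real (Suc a) / x ^ k * (2 ^ k * (L / real k) ^ k)" by simp
  also have "\<dots> \<le> 2 * l / y ^ Suc k * (2 ^ k * (L / real k) ^ k)"
    using 2 \<open>L \<ge> 0\<close> by (intro mult_right_mono) auto
  also have "\<dots> = 2 ^ Suc k / y ^ Suc k * ((L / real k) ^ k * l)" by simp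
  also have "\<dots> \<le> 2 ^ Suc k / y ^ Suc k * ((L + l) / real (Suc k)) ^ Suc k"
    using pos weighted_am_gm[OF \<open>L \<ge> 0\<close> \<open>l \<ge> 0\<close>, of k] by (intro mult_left_mono) auto
  also have "\<dots> = (2 * (L + l) / (real (Suc k) * y)) ^ Suc k"
    by (simp only: power_mult_distrib power_divide times_divide_times_eq mult_ac)
  also have "L + l = ln (real (q ^ a * m))"
    unfolding ln_prime_power_mult[OF assms(2,5)] L_def l_def by simp
  also have "real (Suc a) * real (num_divisors m) = real (num_divisors (q ^ a * m))"
    unfolding num_divisors_prime_power_mult[OF assms(2,3)] by (simp only: of_nat_mult)
  finally show ?thesis
    unfolding divisor_bound_def omega_prime_power_mult[OF assms(2-5)] k_def[symmetric] y_def .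
qed

section \<open>Estimates of ln and exp for the step from k to k + 1\<close>

lemma ln_le_half_diff_inverse:
  assumes "x \<ge> (1::real)"
  shows "ln x \<le> (x - 1 / x) / 2"
proof -
  have "(1 - 1 / 1) / 2 - ln 1 \<le> (x - 1 / x) / 2 - ln x"
  proof (rule DERIV_nonneg_imp_nondecreasing[OF assms])
    fix t :: real assume "1 \<le> t"
    then have "((\<lambda>x. (x - 1 / x) / 2 - ln x) has_real_derivative (1 - 1 / t)\<^sup>2 / 2) (at t)"
      by (auto intro!: derivative_eq_intros simp: power2_eq_square field_simps)
    then show "\<exists>y. ((\<lambda>x. (x - 1 / x) / 2 - ln x) has_real_derivative y) (at t) \<and> 0 \<le> y"
      by auto
  qed
  then show ?thesis by simp
qed

text \<open>Taylor's formula with Lagrange remainder: exp t <= 3/2 on this range, and (3/2) / 3! =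
  1/4. The end point 5/14 bounds 1 / ln k for k >= 17.\<close>

lemma exp_le_cubic:
  assumes "0 \<le> y" "y \<le> (5 / 14::real)"
  shows "exp y \<le> 1 + y + y\<^sup>2 / 2 + y ^ 3 / 4"
proof -
  obtain t where t: "\<bar>t\<bar> \<le> \<bar>y\<bar>" "exp y = (\<Sum>m<3. y ^ m / fact m) + exp t / fact 3 * y ^ 3"
    using Maclaurin_exp_le by blast
  have "exp t \<le> exp (5 / 14)" using t assms by simp
  also have "\<dots> \<le> 1 + 5 / 14 + (5 / 14)\<^sup>2" by (rule exp_bound) auto
  also have "\<dots> \<le> (3 / 2 :: real)" by (simp add: power2_eq_square)
  finally have "exp t / fact 3 * y ^ 3 \<le> (3 / 2) / fact 3 * y ^ 3"
    using assms by (intro mult_right_mono divide_right_mono) auto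
  with t(2) show ?thesis by (simp add: eval_nat_numeral fact_reduce)
qed

text \<open>61 is the 18th prime, and 61/17 is the constant c such that the (k + 1)-st prime is at
  least c * k for all k >= 17.\<close>

lemma ln_61_17: "127 / 100 \<le> ln (61 / 17 :: real)"
proof -
  have "exp (127 / 100 :: real) ^ 100 = exp 1 ^ 127"
    by (simp flip: exp_of_nat_mult)
  also have "\<dots> \<le> (272 / 100) ^ 127"
    using e_less_272 by (intro power_mono) auto
  also have "\<dots> \<le> (61 / 17) ^ 100" by (simp add: field_simps)
  finally have "exp (127 / 100 :: real) \<le> 61 / 17" by (rule power_le_imp_le_base[of _ 99, simplified]) simp
  then show ?thesis by (subst ln_ge_iff) auto
qed

lemma ln_ge_14_5:
  assumes "k \<ge> 17"
  shows "14 / 5 \<le> ln (real k)"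
proof -
  have "exp (14 / 5 :: real) ^ 5 = exp 1 ^ 14"
    by (simp flip: exp_of_nat_mult)
  also have "\<dots> \<le> (272 / 100) ^ 14"
    using e_less_272 by (intro power_mono) auto
  also have "\<dots> \<le> 17 ^ 5" by (simp add: field_simps)
  finally have "exp (14 / 5 :: real) \<le> 17" by (rule power_le_imp_le_base[of _ 4, simplified]) simp
  with assms have "exp (14 / 5) \<le> real k" by linarith
  with assms show ?thesis by (subst ln_ge_iff) auto
qed

text \<open>With L = ln k, d = ln (k + 1) - ln k and y = k * d / L, the claim divided by L ^ k
  follows from (1 + d / L) ^ k <= exp y and (L + d) * exp y <= L + 1.27 <= ln (61 * k / 17).\<close>

lemma ln_Suc_power_le_ln_nth_prime:
  assumes "k \<ge> 17"
  shows "ln (real (Suc k)) ^ Suc k \<le> ln (real (nth_prime (Suc k))) * ln (real k) ^ k"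
proof -
  define L where "L = ln (real k)"
  define d where "d = ln (real (Suc k) / real k)"
  define y where "y = real k * d / L"
  have k: "real k \<ge> 17" using assms by simp
  have L: "L \<ge> 14 / 5" unfolding L_def using assms by (rule ln_ge_14_5)
  have M: "ln (real (Suc k)) = L + d" using k by (simp add: L_def d_def ln_div)
  have d0: "d \<ge> 0" using k by (simp add: d_def)
  \<comment> \<open>The right side is the mean of 1 / k and 1 / (k + 1), which is sharper than d <=
    1 / k.\<close>
  have "d \<le> (real (Suc k) / real k - 1 / (real (Suc k) / real k)) / 2"
    unfolding d_def using k by (intro ln_le_half_diff_inverse) simp
  also have "\<dots> = (2 * real k + 1) / (2 * real k * (real k + 1))"
    using k by (simp add: field_simps)
  finally have d: "d \<le> (2 * real k + 1) / (2 * real k * (real k + 1))" .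
  then have "real k * d \<le> real k * ((2 * real k + 1) / (2 * real k * (real k + 1)))"
    using k by (intro mult_left_mono) auto
  also have "\<dots> = (2 * real k + 1) / (2 * (real k + 1))" using k by simp
  also have "\<dots> \<le> 1" using k by (simp add: divide_le_eq)
  finally have kd: "real k * d \<le> 1" .
  have "y \<le> 1 / L" unfolding y_def using kd L by (intro divide_right_mono) auto
  also have "\<dots> \<le> 5 / 14" using L by (simp add: field_simps)
  finally have y: "y \<le> 5 / 14" .
  have y0: "y \<ge> 0" using d0 L k by (simp add: y_def)
  have y2: "y\<^sup>2 \<le> (5 / 14)\<^sup>2" and y3: "y ^ 3 \<le> (5 / 14) ^ 3" using y y0 by (auto intro: power_mono)
  have ey: "exp y \<le> 1 + y + y\<^sup>2 / 2 + y ^ 3 / 4" using y0 y by (rule exp_le_cubic)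
  have Ly: "L * y = real k * d" using L by (simp add: y_def)
  have "L * exp y \<le> L * (1 + y + y\<^sup>2 / 2 + y ^ 3 / 4)" using ey L by (intro mult_left_mono) auto
  also have "\<dots> = L + (L * y) * (1 + y / 2 + y\<^sup>2 / 4)" by (simp add: algebra_simps power2_eq_square power3_eq_cube)
  \<comment> \<open>1.211 exceeds 1 + y / 2 + y ^ 2 / 4 at y = 5/14, and 1.433 below exceeds the
    cubic bound for exp y there.\<close>
  also have "\<dots> \<le> L + (real k * d) * (1211 / 1000)"
    unfolding Ly using y y2 d0 k by (intro add_left_mono mult_left_mono) (auto simp: power2_eq_square)
  finally have 1: "L * exp y \<le> L + real k * d * (1211 / 1000)" .
  have "exp y \<le> 1433 / 1000" using ey y y2 y3 by (simp add: power2_eq_square power3_eq_cube)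
  then have 2: "d * exp y \<le> d * (1433 / 1000)" using d0 by (rule mult_left_mono)
  have "(L + d) * exp y \<le> L + d * (1211 / 1000 * real k + 1433 / 1000)"
    using 1 2 by (simp add: algebra_simps)
  also have "\<dots> \<le> L + (2 * real k + 1) / (2 * real k * (real k + 1)) * (1211 / 1000 * real k + 1433 / 1000)"
    using d k by (intro add_left_mono mult_right_mono) auto
  also have "\<dots> \<le> L + 127 / 100"
  proof -
    \<comment> \<open>After clearing denominators, the difference of the sides is 0.118 * K - 1.537
      * k - 1.433, which exceeds the nonnegative product below.\<close>
    define K where "K = real k * real k"
    have "(real k - 17) * (118 / 1000 * real k + 469 / 1000)
        = 118 / 1000 * K - 1537 / 1000 * real k - 7973 / 1000" by (simp add: K_def field_simps)
    moreover have "0 \<le> (real k - 17) * (118 / 1000 * real k + 469 / 1000)" using k by simp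
    ultimately have 0: "0 \<le> 118 / 1000 * K - 1537 / 1000 * real k - 7973 / 1000" by metis
    have 1: "(2 * real k + 1) * (1211 / 1000 * real k + 1433 / 1000)
        = 2422 / 1000 * K + 4077 / 1000 * real k + 1433 / 1000" by (simp add: K_def field_simps)
    have 2: "127 / 100 * (2 * real k * (real k + 1)) = 254 / 100 * K + 254 / 100 * real k"
      by (simp add: K_def field_simps)
    have "(2 * real k + 1) * (1211 / 1000 * real k + 1433 / 1000) \<le> 127 / 100 * (2 * real k * (real k + 1))"
      unfolding 1 2 using 0 by simp
    then show ?thesis using k by (simp add: divide_le_eq)
  qed
  also have "\<dots> \<le> L + ln (61 / 17)" using ln_61_17 by simp
  also have "\<dots> = ln (real k * (61 / 17))" unfolding L_def using k by (subst ln_mult) auto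
  also have "\<dots> \<le> ln (real (nth_prime (Suc k)))"
  proof -
    \<comment> \<open>15 * (k + 1) - 26 = 15 * k - 11 is at least 4 * (61/17) * k exactly when k >=
      17.\<close>
    have "15 * Suc k \<le> 4 * nth_prime (Suc k) + 26" using assms by (intro nth_prime_lower_bound) simp
    then have "15 * real (Suc k) \<le> 4 * real (nth_prime (Suc k)) + 26" by linarith
    then have "real k * (61 / 17) \<le> real (nth_prime (Suc k))" using k by simp
    then show ?thesis using k by (subst ln_le_cancel_iff) auto
  qed
  finally have 3: "(L + d) * exp y \<le> ln (real (nth_prime (Suc k)))" .
  have "(1 + d / L) ^ k \<le> exp (d / L) ^ k" using d0 L by (intro power_mono) auto
  also have "\<dots> = exp y" by (simp add: y_def flip: exp_of_nat_mult)
  finally have 4: "(1 + d / L) ^ k \<le> exp y" .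
  have "(L + d) ^ Suc k = (L + d) * (L ^ k * (1 + d / L) ^ k)"
    using L by (simp add: field_simps flip: power_mult_distrib)
  also have "\<dots> \<le> (L + d) * (L ^ k * exp y)"
    using 4 L d0 by (intro mult_left_mono) auto
  also have "\<dots> = ((L + d) * exp y) * L ^ k" by simp
  also have "\<dots> \<le> ln (real (nth_prime (Suc k))) * L ^ k" using 3 L by (intro mult_right_mono) auto
  finally show ?thesis unfolding M L_def[symmetric] .
qed

section \<open>At most 17 prime factors\<close>

lemma primorial_values:
  shows primorial_1: "primorial 1 = 2"
    and primorial_2: "primorial 2 = 6"
    and primorial_3: "primorial 3 = 30"
    and primorial_4: "primorial 4 = 210"
    and primorial_5: "primorial 5 = 2310"
    and primorial_6: "primorial 6 = 30030"
    and primorial_7: "primorial 7 = 510510"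
    and primorial_8: "primorial 8 = 9699690"
    and primorial_9: "primorial 9 = 223092870"
    and primorial_10: "primorial 10 = 6469693230"
    and primorial_11: "primorial 11 = 200560490130"
    and primorial_12: "primorial 12 = 7420738134810"
    and primorial_13: "primorial 13 = 304250263527210"
    and primorial_14: "primorial 14 = 13082761331670030"
    and primorial_15: "primorial 15 = 614889782588491410"
    and primorial_16: "primorial 16 = 32589158477190044730"
    and primorial_17: "primorial 17 = 1922760350154212639070"
proof -
  have "primorial (Suc 0) = 2" using nth_prime_1 by (simp add: primorial_Suc)
  then show 1: "primorial 1 = 2" by simp
  show 2: "primorial 2 = 6" using primorial_Suc[of 1] 1 nth_prime_2 by (simp only: Suc_1)
  show 3: "primorial 3 = 30" using primorial_Suc[of 2] 2 nth_prime_3 by simp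
  show 4: "primorial 4 = 210" using primorial_Suc[of 3] 3 nth_prime_4 by simp
  show 5: "primorial 5 = 2310" using primorial_Suc[of 4] 4 nth_prime_5 by simp
  show 6: "primorial 6 = 30030" using primorial_Suc[of 5] 5 nth_prime_6 by simp
  show 7: "primorial 7 = 510510" using primorial_Suc[of 6] 6 nth_prime_7 by simp
  show 8: "primorial 8 = 9699690" using primorial_Suc[of 7] 7 nth_prime_8 by simp
  show 9: "primorial 9 = 223092870" using primorial_Suc[of 8] 8 nth_prime_9 by simp
  show 10: "primorial 10 = 6469693230" using primorial_Suc[of 9] 9 nth_prime_10 by simp
  show 11: "primorial 11 = 200560490130" using primorial_Suc[of 10] 10 nth_prime_11 by simp
  show 12: "primorial 12 = 7420738134810" using primorial_Suc[of 11] 11 nth_prime_12 by simp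
  show 13: "primorial 13 = 304250263527210" using primorial_Suc[of 12] 12 nth_prime_13 by simp
  show 14: "primorial 14 = 13082761331670030" using primorial_Suc[of 13] 13 nth_prime_14 by simp
  show 15: "primorial 15 = 614889782588491410" using primorial_Suc[of 14] 14 nth_prime_15 by simp
  show 16: "primorial 16 = 32589158477190044730" using primorial_Suc[of 15] 15 nth_prime_16 by simp
  show 17: "primorial 17 = 1922760350154212639070" using primorial_Suc[of 16] 16 nth_prime_17 by simp
qed

lemma ex_nth_prime:
  assumes "prime p"
  obtains i where "i \<ge> 1" "nth_prime i = p"
proof -
  obtain j where "enumerate {p::nat. prime p} j = p"
    using enumerate_Ex[OF primes_infinite, of p] assms by auto
  then show ?thesis using that[of "Suc j"] by (simp add: nth_prime_def)
qed

text \<open>A prime factor outside the first k primes is at least the next prime, and the other k -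
  1 multiply to at least their primorial. This gains room when n is not 24 *
  \<open>primorial 16\<close>.\<close>

lemma radical_eq_or_ge:
  assumes k: "omega n = k" "k > 0"
  shows "\<Prod>(prime_factors n) = primorial k \<or>
    nth_prime (Suc k) * primorial (k - 1) \<le> \<Prod>(prime_factors n)"
proof (cases "prime_factors n \<subseteq> nth_prime ` {1..k}")
  case True
  have inj: "inj_on nth_prime {1..k}"
    using nth_prime_strict_mono by (intro linorder_inj_onI') (auto simp: less_imp_neq)
  then have "prime_factors n = nth_prime ` {1..k}"
    using True k(1) by (intro card_subset_eq) (auto simp: card_image omega_def)
  with inj show ?thesis by (simp add: primorial_def prod.reindex)
next
  case False
  then obtain p where p: "p \<in> prime_factors n" "p \<notin> nth_prime ` {1..k}" by auto
  then obtain i where i: "i \<ge> 1" "nth_prime i = p" using ex_nth_prime[of p] by auto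
  with p have "i > k" by (metis atLeastAtMost_iff image_eqI not_less)
  then have "nth_prime (Suc k) \<le> p" using nth_prime_mono[of "Suc k" i] i by simp
  moreover have "primorial (card (prime_factors n - {p})) \<le> \<Prod>(prime_factors n - {p})"
    by (intro primorial_le_prod_primes) auto
  moreover have "card (prime_factors n - {p}) = k - 1" using p k by (simp add: omega_def)
  ultimately have "nth_prime (Suc k) * primorial (k - 1) \<le> p * \<Prod>(prime_factors n - {p})"
    by (metis mult_le_mono)
  also have "\<dots> = \<Prod>(prime_factors n)" using p by (subst prod.remove[of _ p]) auto
  finally show ?thesis ..
qed

text \<open>Turns a comparison of integer powers, decided by computation, into a rational lower
  bound for a quotient of logarithms.\<close>

lemma ln_ratio_ge:
  assumes "k ^ u \<le> n ^ v" "k \<ge> (2::nat)" "v > 0" "n > (0::nat)"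
  shows "real u / real v \<le> ln (real n) / ln (real k)"
proof -
  have "real k ^ u \<le> real n ^ v" using assms(1) by (metis of_nat_le_iff of_nat_power)
  then have "ln (real k ^ u) \<le> ln (real n ^ v)" using assms by (subst ln_le_cancel_iff) auto
  then have "real u * ln (real k) \<le> real v * ln (real n)" using assms by (simp add: ln_realpow)
  moreover have "ln (real k) > 0" using assms by simp
  ultimately show ?thesis using assms by (simp add: field_simps)
qed

section \<open>Criteria in terms of the excess and its supporting power\<close>

lemma divisor_bound_of_excess:
  assumes "omega n = k" "k \<ge> 2" "real (num_divisors n) \<le> 2 ^ k * h"
    and h: "h \<le> (ln (real n) / (real k * ln (real k))) ^ k"
  shows "divisor_bound n"
proof -
  have "2 ^ k * h \<le> 2 ^ k * (ln (real n) / (real k * ln (real k))) ^ k" using h by simp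
  also have "\<dots> = (2 * ln (real n) / (real k * ln (real k))) ^ k"
    by (simp add: power_mult_distrib power_divide)
  finally show ?thesis using assms by (simp add: divisor_bound_def log_plus_ge_2)
qed

text \<open>\<open>u / v\<close> is a rational lower bound for the logarithm of \<open>n0\<close> to
  base k.\<close>

lemma divisor_bound_of_excess_numeric:
  assumes "omega n = k" "k \<ge> 2" "real (num_divisors n) \<le> 2 ^ k * h"
    and "n0 \<le> n" "n0 > 0" "k ^ u \<le> n0 ^ v" "v > 0" "h \<le> (real u / (real v * real k)) ^ k"
  shows "divisor_bound n"
proof (rule divisor_bound_of_excess[OF assms(1-3)])
  have "k ^ u \<le> n ^ v" using assms(4,6) by (meson le_trans power_mono zero_le)
  then have "real u / real v \<le> ln (real n) / ln (real k)"
    using assms by (intro ln_ratio_ge) auto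
  then have "real u / real v / real k \<le> ln (real n) / ln (real k) / real k"
    by (intro divide_right_mono) auto
  then have "(real u / (real v * real k)) ^ k \<le> (ln (real n) / (real k * ln (real k))) ^ k"
    by (intro power_mono) (auto simp: mult.commute)
  with assms(8) show "h \<le> (ln (real n) / (real k * ln (real k))) ^ k" by linarith
qed

text \<open>The fifteenth power of (A + 2) / 5 <= 2 powr (4 * (A - 3) / 15), with equality at A = 3.
  From there on, a step multiplies A + 2 by at most 6/5, and (6/5) ^ 15 <= 16.\<close>

lemma power_2_line: "(real A + 2) ^ 15 * 2 ^ 12 \<le> 5 ^ 15 * 16 ^ A"
proof (induction A)
  case (Suc A)
  show ?case
  proof (cases "A \<ge> 3")
    case True
    have "5 ^ 15 * (real A + 3) ^ 15 = (5 * (real A + 3)) ^ 15" by (simp only: power_mult_distrib)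
    also have "\<dots> \<le> (6 * (real A + 2)) ^ 15" using True by (intro power_mono) auto
    also have "\<dots> = 6 ^ 15 * (real A + 2) ^ 15" by (simp only: power_mult_distrib)
    also have "\<dots> \<le> (16 * 5 ^ 15) * (real A + 2) ^ 15" by (intro mult_right_mono) auto
    finally have "(real A + 3) ^ 15 \<le> 16 * (real A + 2) ^ 15" by simp
    moreover have "real (Suc A) + 2 = real A + 3" by simp
    ultimately show ?thesis using Suc by (simp only: power_Suc) simp
  next
    case False
    then have "A = 0 \<or> A = 1 \<or> A = 2" by auto
    then show ?thesis by auto
  qed
qed simp

text \<open>Likewise for (B + 2) / 3 <= 3 powr (4 * (B - 1) / 15), with equality at B = 1 and growth
  factor at most 4/3.\<close>

lemma power_3_line: "(real B + 2) ^ 15 * 3 ^ 4 \<le> 3 ^ 15 * 81 ^ B"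
proof (induction B)
  case (Suc B)
  show ?case
  proof (cases "B \<ge> 1")
    case True
    have "3 ^ 15 * (real B + 3) ^ 15 = (3 * (real B + 3)) ^ 15" by (simp only: power_mult_distrib)
    also have "\<dots> \<le> (4 * (real B + 2)) ^ 15" using True by (intro power_mono) auto
    also have "\<dots> = 4 ^ 15 * (real B + 2) ^ 15" by (simp only: power_mult_distrib)
    also have "\<dots> \<le> (81 * 3 ^ 15) * (real B + 2) ^ 15" by (intro mult_right_mono) auto
    finally have "(real B + 3) ^ 15 \<le> 81 * (real B + 2) ^ 15" by simp
    moreover have "real (Suc B) + 2 = real B + 3" by simp
    ultimately show ?thesis using Suc by (simp only: power_Suc) simp
  qed (simp add: not_le)
qed simp

text \<open>Equality holds for \<open>A = 3\<close>, \<open>B = 1\<close>, \<open>s = 0\<close>, that is for the extremal \<open>n = 24 * primorial 16\<close>.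
  Any slope between \<open>log 2 (6 / 5)\<close> and \<open>log 2 (5 / 4)\<close> in place of 4/15 would have this property; a
  slope close to the lower end is needed for \<open>omega n = 16\<close>.\<close>

lemma excess_line:
  "((real A + 2) / 2 * ((real B + 2) / 2) * (3 / 2) ^ s) ^ 15
    \<le> (15 / 4) ^ 15 * (real (2 ^ A * 3 ^ B * 5 ^ s) / 24) ^ 4"
proof -
  have A: "((real A + 2) / 2) ^ 15 \<le> (5 / 2) ^ 15 / 2 ^ 12 * (2 ^ A) ^ 4"
  proof -
    have "((2::real) ^ A) ^ 4 = (2 ^ 4) ^ A" by (metis mult.commute power_mult)
    then show ?thesis using power_2_line[of A] by (simp add: power_divide)
  qed
  have B: "((real B + 2) / 2) ^ 15 \<le> (3 / 2) ^ 15 / 3 ^ 4 * (3 ^ B) ^ 4"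
  proof -
    have "((3::real) ^ B) ^ 4 = (3 ^ 4) ^ B" by (metis mult.commute power_mult)
    then show ?thesis using power_3_line[of B] by (simp add: power_divide)
  qed
  have "((3 / 2 :: real) ^ 15) ^ s \<le> (5 ^ 4) ^ s" by (intro power_mono) (auto simp: power_divide)
  then have s: "((3 / 2 :: real) ^ s) ^ 15 \<le> (5 ^ s) ^ 4" by (metis mult.commute power_mult)
  have "((real A + 2) / 2 * ((real B + 2) / 2) * (3 / 2) ^ s) ^ 15
      = ((real A + 2) / 2) ^ 15 * ((real B + 2) / 2) ^ 15 * ((3 / 2) ^ s) ^ 15"
    by (simp only: power_mult_distrib)
  also have "\<dots> \<le> ((5 / 2) ^ 15 / 2 ^ 12 * (2 ^ A) ^ 4) * ((3 / 2) ^ 15 / 3 ^ 4 * (3 ^ B) ^ 4) * (5 ^ s) ^ 4"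
    using A B s by (intro mult_mono) auto
  also have "\<dots> = (15 / 4) ^ 15 * (real (2 ^ A * 3 ^ B * 5 ^ s) / 24) ^ 4"
    by (simp add: power_mult_distrib power_divide)
  finally show ?thesis .
qed

text \<open>By \<open>excess_line\<close> the bound for h grows like n powr (4/15). As a function of
  ln n, (ln n) ^ k has logarithmic derivative k / ln n, which is at least 4/15 while ln n <= 15 * k
  / 4. So a check at \<open>n0\<close>, which belongs to t = 24 * c, suffices.\<close>

lemma divisor_bound_line:
  assumes k: "omega n = k" "k \<ge> 2" and n0: "n0 = 24 * c * primorial k" "c > 0" "n0 \<le> n"
    and n: "ln (real n) \<le> 15 * real k / 4"
    and u: "k ^ u \<le> n0 ^ v" "v > 0" "(15 / 4) ^ 15 * real c ^ 4 \<le> (real u / (real v * real k)) ^ (15 * k)"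
  shows "divisor_bound n"
proof -
  have Q: "primorial k > 0" by (rule primorial_pos)
  have n0pos: "n0 > 0" using n0 Q by simp
  then have npos: "n > 0" using n0(3) by linarith
  obtain t A B s where t: "t * primorial k \<le> n" "2 ^ A * 3 ^ B * 5 ^ s \<le> t"
    "real (num_divisors n) \<le> 2 ^ k * ((real A + 2) / 2 * ((real B + 2) / 2) * (3 / 2) ^ s)"
    by (rule excess_decomposition[OF npos, unfolded k(1)], rule that)
  define h where "h = (real A + 2) / 2 * ((real B + 2) / 2) * (3 / 2) ^ s"
  \<comment> \<open>x is the base of the power at \<open>n0\<close>, and r its growth from
    \<open>n0\<close> to n.\<close>
  define x where "x = ln (real n0) / (real k * ln (real k))"
  define r where "r = ln (real n) / ln (real n0)"
  define z where "z = ln (real n / real n0)"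
  have "2 ^ A * 3 ^ B * 5 ^ s * primorial k \<le> n" using t(1,2) by (meson le_trans mult_le_mono1)
  then have "real (2 ^ A * 3 ^ B * 5 ^ s) * real (primorial k) \<le> real n"
    by (metis of_nat_le_iff of_nat_mult)
  then have t24: "real (2 ^ A * 3 ^ B * 5 ^ s) / 24 \<le> real n / (24 * real (primorial k))"
    using Q by (simp add: field_simps)
  have nn: "real n / (24 * real (primorial k)) = real c * (real n / real n0)"
    using n0 Q by (simp add: field_simps)
  have k1: "ln (real k) > 0" using k by simp
  have "24 \<le> n0" using n0 Q by (simp add: Suc_le_eq)
  then have l0: "ln (real n0) > 0" by simp
  have l: "ln (real n) \<ge> ln (real n0)" using n0pos n0(3) by simp
  have z0: "z \<ge> 0" using n0(3) n0pos by (simp add: z_def)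
  have z: "z = ln (real n) - ln (real n0)" using npos n0pos by (simp add: z_def ln_div)
  have rpos: "r > 0" using l l0 by (simp add: r_def)
  \<comment> \<open>This leads to ln r >= 1 - 1 / r in exponential form.\<close>
  have "1 / r \<le> exp (1 / r - 1)" using exp_ge_add_one_self[of "1 / r - 1"] by simp
  then have "inverse (exp (1 / r - 1)) \<le> inverse (1 / r)"
    using rpos by (intro le_imp_inverse_le) auto
  then have r: "exp (1 - 1 / r) \<le> r" by (simp flip: exp_minus)
  have "1 - 1 / r = z / ln (real n)" using l l0 by (simp add: r_def z diff_divide_distrib)
  moreover have "4 * z \<le> real (15 * k) * (z / ln (real n))"
    using n l l0 z0 mult_right_mono[OF n z0] by (simp add: field_simps)
  ultimately have "exp (4 * z) \<le> exp (real (15 * k) * (1 - 1 / r))" by simp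
  also have "\<dots> = exp (1 - 1 / r) ^ (15 * k)" by (rule exp_of_nat_mult)
  also have "\<dots> \<le> r ^ (15 * k)" using r by (intro power_mono) auto
  finally have rz: "exp (4 * z) \<le> r ^ (15 * k)" .
  have "exp (4 * z) = exp z ^ 4" using exp_of_nat_mult[of 4 z] by simp
  also have "\<dots> = (real n / real n0) ^ 4" using npos n0pos by (simp add: z_def)
  finally have ez: "(real n / real n0) ^ 4 \<le> r ^ (15 * k)" using rz by simp
  have "real u / real v \<le> ln (real n0) / ln (real k)"
    using u k n0pos by (intro ln_ratio_ge) auto
  then have "real u / real v / real k \<le> ln (real n0) / ln (real k) / real k"
    by (intro divide_right_mono) auto
  then have ux: "(real u / (real v * real k)) ^ (15 * k) \<le> x ^ (15 * k)"
    unfolding x_def by (intro power_mono) (auto simp: mult.commute)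
  have "h ^ 15 \<le> (15 / 4) ^ 15 * (real (2 ^ A * 3 ^ B * 5 ^ s) / 24) ^ 4"
    unfolding h_def by (rule excess_line)
  also have "\<dots> \<le> (15 / 4) ^ 15 * (real c * (real n / real n0)) ^ 4"
    using t24 unfolding nn by (intro mult_left_mono power_mono) auto
  also have "\<dots> = ((15 / 4) ^ 15 * real c ^ 4) * (real n / real n0) ^ 4"
    by (simp only: power_mult_distrib mult.assoc)
  also have "\<dots> \<le> x ^ (15 * k) * r ^ (15 * k)"
    using ez u(3) ux l0 k1 by (intro mult_mono) (auto simp: x_def)
  also have "\<dots> = ((ln (real n) / (real k * ln (real k))) ^ k) ^ 15"
  proof -
    have "x * r = ln (real n) / (real k * ln (real k))" using l0 by (simp add: x_def r_def)
    then show ?thesis by (simp flip: power_mult_distrib power_mult add: mult.commute)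
  qed
  finally have "h \<le> (ln (real n) / (real k * ln (real k))) ^ k"
    using l l0 k1 by (subst (asm) power_mono_iff) (auto simp: h_def)
  with t(3) k show ?thesis by (intro divisor_bound_of_excess[of n k h]) (auto simp: h_def)
qed

section \<open>Numerical criteria: AM-GM with logarithms to base 2, small excess\<close>

text \<open>The entries are the floors of \<open>50 * log 2 p\<close> for the first 17 primes \<open>p\<close>.\<close>

definition log2_table :: "nat list" where
  "log2_table = [50, 79, 116, 140, 172, 185, 204, 212, 226, 242, 247, 260, 267, 271, 277, 286, 294]"

lemma log2_table_le:
  assumes "i < 17"
  shows "real (log2_table ! i) / 50 * ln 2 \<le> ln (real (nth_prime (Suc i)))"
proof -
  have "i = 0 \<or> i = 1 \<or> i = 2 \<or> i = 3 \<or> i = 4 \<or> i = 5 \<or> i = 6 \<or> i = 7 \<or>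
    i = 8 \<or> i = 9 \<or> i = 10 \<or> i = 11 \<or> i = 12 \<or> i = 13 \<or> i = 14 \<or> i = 15 \<or> i = 16"
    using assms by arith
  then have "2 ^ (log2_table ! i) \<le> nth_prime (Suc i) ^ 50"
    by (elim disjE) (simp_all add: log2_table_def nth_prime_values nth_prime_1[simplified]
        nth_prime_2[unfolded numeral_2_eq_2])
  then have "real (log2_table ! i) / real 50 \<le> ln (real (nth_prime (Suc i))) / ln (real 2)"
    using prime_gt_0_nat[OF prime_nth_prime] by (intro ln_ratio_ge) auto
  then show ?thesis by (simp add: field_simps)
qed

lemma log2_table_prod_le:
  assumes "k \<le> 17"
  shows "(\<Prod>l\<leftarrow>take k log2_table. real l / 50) * ln 2 ^ k \<le> (\<Prod>i=1..k. ln (real (nth_prime i)))"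
  using assms
proof (induction k)
  case (Suc k)
  have "((\<Prod>l\<leftarrow>take k log2_table. real l / 50) * ln 2 ^ k) * (real (log2_table ! k) / 50 * ln 2)
      \<le> (\<Prod>i=1..k. ln (real (nth_prime i))) * ln (real (nth_prime (Suc k)))"
    using Suc log2_table_le[of k] prime_ge_1_nat[OF prime_nth_prime]
    by (intro mult_mono prod_nonneg) (auto simp: real_of_nat_ge_one_iff)
  moreover have "length log2_table = 17" by (simp add: log2_table_def)
  ultimately show ?case using Suc.prems by (simp add: take_Suc_conv_app_nth mult_ac)
qed simp

lemma ln_nth_prime_pos: "ln (real (nth_prime i)) > 0"
  using prime_gt_1_nat[OF prime_nth_prime[of i]] by simp

text \<open>\<open>v / u\<close> bounds the quotient of ln (primorial k) by ln n, and
  \<open>w / 50\<close> bounds the logarithm of k to base 2. With the table for the primes, the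
  powers of ln 2 cancel and the rational inequality \<open>num\<close> remains.\<close>

lemma divisor_bound_am_gm:
  assumes k: "omega n = k" "2 \<le> k" "k \<le> 17" and n: "n0 \<le> n" "n0 \<ge> 2"
    and v: "primorial k ^ u \<le> n0 ^ v" "u > 0" and w: "k ^ 50 \<le> 2 ^ w"
    and num: "((1 + real v / real u) * (real w / 50)) ^ k \<le> 2 ^ k * (\<Prod>l\<leftarrow>take k log2_table. real l / 50)"
  shows "divisor_bound n"
proof -
  define X where "X = ln (real n)"
  define T where "T = (\<Prod>i=1..k. ln (real (nth_prime i)))"
  have X: "X > 0" using n by (simp add: X_def)
  have Tpos: "T > 0"
    unfolding T_def by (intro prod_pos ln_nth_prime_pos)
  have "primorial k ^ u \<le> n ^ v" using v(1) n(1) by (meson le_trans power_mono zero_le)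
  then have "real (primorial k) ^ u \<le> real n ^ v" by (metis of_nat_le_iff of_nat_power)
  then have "ln (real (primorial k) ^ u) \<le> ln (real n ^ v)"
    using primorial_pos[of k] n by (subst ln_le_cancel_iff) auto
  then have Q: "ln (real (primorial k)) \<le> real v / real u * X"
    using primorial_pos[of k] n v(2) by (simp add: ln_realpow X_def field_simps)
  have "real k ^ 50 \<le> 2 ^ w" using w by (metis of_nat_le_iff of_nat_power of_nat_numeral)
  then have "ln (real k ^ 50) \<le> ln (2 ^ w)" using k by (subst ln_le_cancel_iff) auto
  then have lk: "ln (real k) \<le> real w / 50 * ln 2" using k by (simp add: ln_realpow)
  have lk0: "ln (real k) > 0" using k by simp
  have "real (num_divisors n) * T \<le> ((X + ln (real (primorial k))) / real k) ^ k"
    using num_divisors_am_gm[of n] n k by (simp add: T_def X_def)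
  also have "\<dots> \<le> ((1 + real v / real u) * X / real k) ^ k"
    using Q X primorial_pos[of k] by (intro power_mono divide_right_mono) (auto simp: algebra_simps)
  finally have 1: "real (num_divisors n) * T \<le> ((1 + real v / real u) * X / real k) ^ k" .
  have "((1 + real v / real u) * ln (real k)) ^ k \<le> ((1 + real v / real u) * (real w / 50 * ln 2)) ^ k"
    using lk lk0 by (intro power_mono mult_left_mono) auto
  also have "\<dots> = ((1 + real v / real u) * (real w / 50)) ^ k * ln 2 ^ k"
    by (simp only: power_mult_distrib mult.assoc)
  also have "\<dots> \<le> 2 ^ k * (\<Prod>l\<leftarrow>take k log2_table. real l / 50) * ln 2 ^ k"
    using num by (rule mult_right_mono) simp
  also have "\<dots> \<le> 2 ^ k * T"
    using log2_table_prod_le[OF k(3)] by (simp add: T_def)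
  finally have 2: "((1 + real v / real u) * ln (real k)) ^ k \<le> 2 ^ k * T" .
  have "real (num_divisors n) * T * ln (real k) ^ k \<le> ((1 + real v / real u) * X / real k) ^ k * ln (real k) ^ k"
    using 1 lk0 by (intro mult_right_mono) auto
  also have "\<dots> = (X / real k) ^ k * ((1 + real v / real u) * ln (real k)) ^ k"
    by (simp only: power_mult_distrib power_divide times_divide_eq_left times_divide_eq_right mult_ac)
  also have "\<dots> \<le> (X / real k) ^ k * (2 ^ k * T)" using 2 X by (intro mult_left_mono) auto
  finally have "real (num_divisors n) * ln (real k) ^ k \<le> (X / real k) ^ k * 2 ^ k"
    using Tpos by (simp add: mult_ac)
  then have "real (num_divisors n) \<le> (X / real k) ^ k * 2 ^ k / ln (real k) ^ k"
    using lk0 by (simp add: le_divide_eq)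
  also have "\<dots> = (2 * X / (real k * ln (real k))) ^ k"
    by (simp add: power_mult_distrib power_divide)
  finally show ?thesis using k by (simp add: divisor_bound_def log_plus_ge_2 X_def)
qed

text \<open>The thresholds are the N at which the maximum of h rises; it becomes 15/4 at 24 = 2 ^ 3
  * 3 and 4 at 36 = 2 ^ 2 * 3 ^ 2. Below 36 only N = 24 exceeds 7/2, the value at N = 32.\<close>

lemma small_excess_cases:
  fixes A B s :: nat
  defines "N \<equiv> (2::nat) ^ A * 3 ^ B * 5 ^ s" and "h \<equiv> (real A + 2) / 2 * ((real B + 2) / 2) * (3 / 2) ^ s"
  assumes N: "N < 48"
  shows "N < 2 \<Longrightarrow> h \<le> 1" "N < 4 \<Longrightarrow> h \<le> 3 / 2" "N < 6 \<Longrightarrow> h \<le> 2" "N < 8 \<Longrightarrow> h \<le> 9 / 4"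
    "N < 12 \<Longrightarrow> h \<le> 5 / 2" "N < 24 \<Longrightarrow> h \<le> 3" "N < 36 \<Longrightarrow> h \<le> 15 / 4" "h \<le> 4"
    "N < 36 \<Longrightarrow> h \<le> 7 / 2 \<or> (A = 3 \<and> B = 1 \<and> s = 0)"
proof -
  have "2 ^ A * 1 * 1 \<le> N" "1 * 3 ^ B * 1 \<le> N" "1 * 1 * 5 ^ s \<le> N"
    unfolding N_def by (intro mult_le_mono; simp)+
  then have p: "2 ^ A < (2::nat) ^ 6" "3 ^ B < (3::nat) ^ 4" "5 ^ s < (5::nat) ^ 3" using N by simp_all
  have "A < 6" using p(1) by (rule power_less_imp_less_exp[rotated]) simp
  moreover have "B < 4" using p(2) by (rule power_less_imp_less_exp[rotated]) simp
  moreover have "s < 3" using p(3) by (rule power_less_imp_less_exp[rotated]) simp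
  ultimately have c: "A = 0 \<or> A = 1 \<or> A = 2 \<or> A = 3 \<or> A = 4 \<or> A = 5" "B = 0 \<or> B = 1 \<or> B = 2 \<or> B = 3"
    "s = 0 \<or> s = 1 \<or> s = 2" by auto
  have "(N < 2 \<longrightarrow> h \<le> 1) \<and> (N < 4 \<longrightarrow> h \<le> 3 / 2) \<and> (N < 6 \<longrightarrow> h \<le> 2) \<and> (N < 8 \<longrightarrow> h \<le> 9 / 4) \<and>
    (N < 12 \<longrightarrow> h \<le> 5 / 2) \<and> (N < 24 \<longrightarrow> h \<le> 3) \<and> (N < 36 \<longrightarrow> h \<le> 15 / 4) \<and> h \<le> 4 \<and>
    (N < 36 \<longrightarrow> h \<le> 7 / 2 \<or> (A = 3 \<and> B = 1 \<and> s = 0))"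
    using c N unfolding N_def h_def by (elim disjE) (simp_all add: power2_eq_square)
  then show "N < 2 \<Longrightarrow> h \<le> 1" "N < 4 \<Longrightarrow> h \<le> 3 / 2" "N < 6 \<Longrightarrow> h \<le> 2" "N < 8 \<Longrightarrow> h \<le> 9 / 4"
    "N < 12 \<Longrightarrow> h \<le> 5 / 2" "N < 24 \<Longrightarrow> h \<le> 3" "N < 36 \<Longrightarrow> h \<le> 15 / 4" "h \<le> 4"
    "N < 36 \<Longrightarrow> h \<le> 7 / 2 \<or> (A = 3 \<and> B = 1 \<and> s = 0)"
    by blast+
qed

text \<open>Provides ln n <= 15 * k / 4 for \<open>divisor_bound_line\<close>. The exponents 81, 86,
  91 used for k = 15, 16, 17 are the largest b with 25 * b / 36 <= 15 * k / 4.\<close>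

lemma ln_le_of_less_power_2:
  assumes "n < 2 ^ b" "n > 0"
  shows "ln (real n) \<le> real b * (25 / 36)"
proof -
  have "real n \<le> 2 ^ b" using assms(1) by (metis less_imp_le of_nat_le_iff of_nat_numeral of_nat_power)
  then have "ln (real n) \<le> ln (2 ^ b)" using assms by (subst ln_le_cancel_iff) auto
  also have "\<dots> = real b * ln 2" by (simp add: ln_realpow)
  also have "\<dots> \<le> real b * (25 / 36)" using ln2_le_25_over_36 by (intro mult_left_mono) auto
  finally show ?thesis .
qed

section \<open>The individual numbers of prime factors\<close>

lemma divisor_bound_omega_le_2:
  assumes "n > 0" "omega n \<le> 2"
  shows "divisor_bound n"
  using assms
proof (induction n rule: largest_prime_induct)
  case one
  show ?case by (simp add: divisor_bound_def num_divisors_1[simplified] omega_1[simplified])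
next
  case (prime_power q a m)
  have om: "omega (q ^ a * m) = Suc (omega m)"
    using prime_power by (intro omega_prime_power_mult)
  with prime_power.prems have k: "omega m = 0 \<or> omega m = 1" by auto
  \<comment> \<open>As \<open>log_plus\<close> equals ln 2 at 0, 1 and 2, the condition on q reduces
    to q >= 2.\<close>
  have "ln (real q) \<ge> ln 2" using prime_ge_2_nat[OF prime_power(1)] by simp
  then have "log_plus (real (Suc (omega m))) ^ Suc (omega m) \<le> ln (real q) * log_plus (real (omega m)) ^ omega m"
    using k by (auto simp: log_plus_def)
  with prime_power om show ?case by (intro divisor_bound_prime_power_mult) auto
qed

lemma divisor_bound_omega_3:
  assumes "n > 0" "omega n = 3"
  shows "divisor_bound n"
proof -
  obtain t A B s where t: "t * primorial 3 \<le> n" "t \<ge> 1" "2 ^ A * 3 ^ B * 5 ^ s \<le> t"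
    "real (num_divisors n) \<le> 2 ^ 3 * ((real A + 2) / 2 * ((real B + 2) / 2) * (3 / 2) ^ s)"
    by (rule excess_decomposition[OF assms(1), unfolded assms(2)], rule that)
  show ?thesis
  proof (cases "t < 2")
    \<comment> \<open>Here t = 1, and 3 ^ 3 <= 30 <= n makes ln n / (3 * ln 3) at least 1.\<close>
    case True
    then have "(real A + 2) / 2 * ((real B + 2) / 2) * (3 / 2) ^ s \<le> 1"
      using t(3) by (intro small_excess_cases) auto
    then show ?thesis using assms t
      by (intro divisor_bound_of_excess_numeric[of n 3 _ 30 3 1]) (auto simp: primorial_3)
  next
    case False
    then have "60 \<le> n" using t(1) by (simp add: primorial_3)
    with assms show ?thesis
      by (intro divisor_bound_am_gm[of n 3 "60" 6 5 80])
        (simp_all add: log2_table_def primorial_values power_divide)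
  qed
qed

text \<open>Here and up to 14 prime factors, the last three arguments are u, v with
  \<open>primorial k ^ u \<le> n0 ^ v\<close> for n0 = 24 * \<open>primorial 16\<close>, and w, the
  ceiling of 50 * log 2 k.\<close>

lemma divisor_bound_omega_4:
  assumes "omega n = 4" "n > 782139803452561073520"
  shows "divisor_bound n"
  by (rule divisor_bound_am_gm[of n 4 "782139803452561073520" 2 1 100])
    (use assms in \<open>simp_all add: log2_table_def primorial_values power_divide\<close>)

lemma divisor_bound_omega_5:
  assumes "omega n = 5" "n > 782139803452561073520"
  shows "divisor_bound n"
  by (rule divisor_bound_am_gm[of n 5 "782139803452561073520" 2 1 117])
    (use assms in \<open>simp_all add: log2_table_def primorial_values power_divide\<close>)

lemma divisor_bound_omega_6:
  assumes "omega n = 6" "n > 782139803452561073520"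
  shows "divisor_bound n"
  by (rule divisor_bound_am_gm[of n 6 "782139803452561073520" 2 1 130])
    (use assms in \<open>simp_all add: log2_table_def primorial_values power_divide\<close>)

lemma divisor_bound_omega_7:
  assumes "omega n = 7" "n > 782139803452561073520"
  shows "divisor_bound n"
  by (rule divisor_bound_am_gm[of n 7 "782139803452561073520" 2 1 141])
    (use assms in \<open>simp_all add: log2_table_def primorial_values power_divide\<close>)

lemma divisor_bound_omega_8:
  assumes "omega n = 8" "n > 782139803452561073520"
  shows "divisor_bound n"
  by (rule divisor_bound_am_gm[of n 8 "782139803452561073520" 2 1 150])
    (use assms in \<open>simp_all add: log2_table_def primorial_values power_divide\<close>)

lemma divisor_bound_omega_9:
  assumes "omega n = 9" "n > 782139803452561073520"
  shows "divisor_bound n"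
  by (rule divisor_bound_am_gm[of n 9 "782139803452561073520" 2 1 159])
    (use assms in \<open>simp_all add: log2_table_def primorial_values power_divide\<close>)

lemma divisor_bound_omega_10:
  assumes "omega n = 10" "n > 782139803452561073520"
  shows "divisor_bound n"
  by (rule divisor_bound_am_gm[of n 10 "782139803452561073520" 2 1 167])
    (use assms in \<open>simp_all add: log2_table_def primorial_values power_divide\<close>)

lemma divisor_bound_omega_11:
  assumes "omega n = 11" "n > 782139803452561073520"
  shows "divisor_bound n"
  by (rule divisor_bound_am_gm[of n 11 "782139803452561073520" 3 2 173])
    (use assms in \<open>simp_all add: log2_table_def primorial_values power_divide\<close>)

lemma divisor_bound_omega_12:
  assumes "omega n = 12" "n > 782139803452561073520"
  shows "divisor_bound n"
  by (rule divisor_bound_am_gm[of n 12 "782139803452561073520" 3 2 180])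
    (use assms in \<open>simp_all add: log2_table_def primorial_values power_divide\<close>)

lemma divisor_bound_omega_13:
  assumes "omega n = 13" "n > 782139803452561073520"
  shows "divisor_bound n"
  by (rule divisor_bound_am_gm[of n 13 "782139803452561073520" 4 3 186])
    (use assms in \<open>simp_all add: log2_table_def primorial_values power_divide\<close>)

lemma divisor_bound_omega_14:
  assumes "omega n = 14" "n > 782139803452561073520"
  shows "divisor_bound n"
  by (rule divisor_bound_am_gm[of n 14 "782139803452561073520" 5 4 191])
    (use assms in \<open>simp_all add: log2_table_def primorial_values power_divide\<close>)

lemma divisor_bound_omega_15:
  assumes "omega n = 15" "n > 782139803452561073520"
  shows "divisor_bound n"
proof (cases "n < 2 ^ 81")
  case True
  then have "ln (real n) \<le> 15 * real 15 / 4" using ln_le_of_less_power_2[of n 81] assms by simp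
  with assms show ?thesis
    by (intro divisor_bound_line[of n 15 782139803452561073520 53 53 3])
      (simp_all add: primorial_15 power_divide)
next
  case False
  with assms show ?thesis
    by (intro divisor_bound_am_gm[of n 15 "2 ^ 81" 4 3 196])
      (simp_all add: log2_table_def primorial_values power_divide)
qed

lemma divisor_bound_omega_16:
  assumes "omega n = 16" "n > 782139803452561073520"
  shows "divisor_bound n"
proof (cases "n < 2 ^ 86")
  case True
  have npos: "n > 0" using assms by simp
  obtain t A B s where t: "n = t * \<Prod>(prime_factors n)" "t * primorial 16 \<le> n" "t \<ge> 1"
    "2 ^ A * 3 ^ B * 5 ^ s \<le> t" "s = 0 \<longrightarrow> t = 2 ^ A * 3 ^ B"
    "real (num_divisors n) \<le> 2 ^ 16 * ((real A + 2) / 2 * ((real B + 2) / 2) * (3 / 2) ^ s)"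
    by (rule excess_decomposition[OF npos, unfolded assms(1)], rule that)
  let ?h = "(real A + 2) / 2 * ((real B + 2) / 2) * (3 / 2) ^ s"
  have ln: "ln (real n) \<le> 15 * real 16 / 4" using True ln_le_of_less_power_2[of n 86] assms by simp
  consider "t \<ge> 48" | "36 \<le> t" "t < 48" | "t < 36" by linarith
  then show ?thesis
  proof cases
    case 1
    then have "48 * primorial 16 \<le> n" using t(2) mult_le_mono1[of 48 t "primorial 16"] by linarith
    \<comment> \<open>The starting point is 48 * \<open>primorial 16\<close>, so c = 2.\<close>
    with assms ln show ?thesis
      by (intro divisor_bound_line[of n 16 1564279606905122147040 2 88 5])
        (simp_all add: primorial_16 power_divide)
  next
    case 2
    then have "?h \<le> 4" using t(4) by (intro small_excess_cases) auto
    moreover have "36 * primorial 16 \<le> n" using 2 t(2) mult_le_mono1[of 36 t "primorial 16"] by linarith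
    ultimately show ?thesis using assms t(6)
      by (intro divisor_bound_of_excess_numeric[of n 16 ?h 1173209705178841610280 192 11])
        (simp_all add: primorial_16 power_divide)
  next
    case 3
    then have "?h \<le> 7 / 2 \<or> (A = 3 \<and> B = 1 \<and> s = 0)"
      using t(4) by (intro small_excess_cases(9)) auto
    then show ?thesis
    proof
      assume "?h \<le> 7 / 2"
      then show ?thesis using assms t(6)
        by (intro divisor_bound_of_excess_numeric[of n 16 ?h 782139803452561073520 52 3])
          (simp_all add: power_divide)
    next
      assume h: "A = 3 \<and> B = 1 \<and> s = 0"
      \<comment> \<open>As n is not 24 * \<open>primorial 16\<close> itself, its radical is at least
        59 * \<open>primorial 15\<close>, where 59 is the 17th prime; the larger \<open>n0\<close>
        then allows for h = 15/4.\<close>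
      with t(5) have "t = 24" by simp
      with t(1) assms(2) have "\<Prod>(prime_factors n) \<noteq> primorial 16" by (auto simp: primorial_16)
      then have "nth_prime 17 * primorial 15 \<le> \<Prod>(prime_factors n)"
        using radical_eq_or_ge[OF assms(1)] by simp
      with \<open>t = 24\<close> t(1) have "24 * (59 * primorial 15) \<le> n" by (simp add: nth_prime_17)
      with assms t(6) h show ?thesis
        by (intro divisor_bound_of_excess_numeric[of n 16 ?h 870683932145303836560 226 13])
          (simp_all add: primorial_15 power_divide)
    qed
  qed
next
  case False
  with assms show ?thesis
    by (intro divisor_bound_am_gm[of n 16 "2 ^ 86" 5 4 200])
      (simp_all add: log2_table_def primorial_values power_divide)
qed

text \<open>No size of n is assumed, because the induction for more prime factors starts here. Each
  interval of t below 48 takes h from \<open>small_excess_cases\<close> and n0 = c *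
  \<open>primorial 17\<close> with c its left end.\<close>

lemma divisor_bound_omega_17:
  assumes "omega n = 17" "n > 0"
  shows "divisor_bound n"
proof (cases "n < 2 ^ 91")
  case True
  obtain t A B s where t: "t * primorial 17 \<le> n" "t \<ge> 1" "2 ^ A * 3 ^ B * 5 ^ s \<le> t"
    "real (num_divisors n) \<le> 2 ^ 17 * ((real A + 2) / 2 * ((real B + 2) / 2) * (3 / 2) ^ s)"
    by (rule excess_decomposition[OF assms(2), unfolded assms(1)], rule that)
  define h where "h = (real A + 2) / 2 * ((real B + 2) / 2) * (3 / 2) ^ s"
  have ln: "ln (real n) \<le> 15 * real 17 / 4" using True ln_le_of_less_power_2[of n 91] assms by simp
  note excess = divisor_bound_of_excess_numeric[OF assms(1) _ t(4)[folded h_def]]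
  have le: "c * primorial 17 \<le> n" if "c \<le> t" for c
    using t(1) that by (meson le_trans mult_le_mono1)
  note small = small_excess_cases[of A B s, folded h_def]
  consider "1 \<le> t" "t < 2" | "2 \<le> t" "t < 4" | "4 \<le> t" "t < 6" | "6 \<le> t" "t < 8"
    | "8 \<le> t" "t < 12" | "12 \<le> t" "t < 24" | "24 \<le> t" "t < 36"
    | "36 \<le> t" "t < 48" | "48 \<le> t"
    using t(2) by linarith
  then show ?thesis
  proof cases
    case 1
    then have "h \<le> 1" using t(3) small by simp
    with le[OF 1(1)] show ?thesis
      by (intro excess[of 1922760350154212639070 17 1]) (simp_all add: primorial_17 power_divide)
  next
    case 2
    then have "h \<le> 3 / 2" using t(3) small by simp
    with le[OF 2(1)] show ?thesis
      by (intro excess[of 3845520700308425278140 35 2]) (simp_all add: primorial_17 power_divide)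
  next
    case 3
    then have "h \<le> 2" using t(3) small by simp
    with le[OF 3(1)] show ?thesis
      by (intro excess[of 7691041400616850556280 71 4]) (simp_all add: primorial_17 power_divide)
  next
    case 4
    then have "h \<le> 9 / 4" using t(3) small by simp
    with le[OF 4(1)] show ?thesis
      by (intro excess[of 11536562100925275834420 107 6]) (simp_all add: primorial_17 power_divide)
  next
    case 5
    then have "h \<le> 5 / 2" using t(3) small by simp
    with le[OF 5(1)] show ?thesis
      by (intro excess[of 15382082801233701112560 18 1]) (simp_all add: primorial_17 power_divide)
  next
    case 6
    then have "h \<le> 3" using t(3) small by simp
    with le[OF 6(1)] show ?thesis
      by (intro excess[of 23073124201850551668840 109 6]) (simp_all add: primorial_17 power_divide)
  next
    case 7
    then have "h \<le> 15 / 4" using t(3) small by simp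
    with le[OF 7(1)] show ?thesis
      by (intro excess[of 46146248403701103337680 92 5]) (simp_all add: primorial_17 power_divide)
  next
    case 8
    then have "h \<le> 4" using t(3) small by simp
    with le[OF 8(1)] show ?thesis
      by (intro excess[of 69219372605551655006520 37 2]) (simp_all add: primorial_17 power_divide)
  next
    case 9
    with assms ln le[OF 9] show ?thesis
      by (intro divisor_bound_line[of n 17 92292496807402206675360 2 93 5])
        (simp_all add: primorial_17 power_divide)
  qed
next
  case False
  with assms show ?thesis
    by (intro divisor_bound_am_gm[of n 17 "2 ^ 91" 5 4 205])
      (simp_all add: log2_table_def primorial_values power_divide)
qed

lemma divisor_bound_omega_ge_17:
  assumes "n > 0" "omega n \<ge> 17"
  shows "divisor_bound n"
  using assms
proof (induction n rule: largest_prime_induct)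
  case (prime_power q a m)
  have om: "omega (q ^ a * m) = Suc (omega m)"
    using prime_power by (intro omega_prime_power_mult)
  show ?case
  proof (cases "omega m \<ge> 17")
    case True
    have "ln (real (nth_prime (Suc (omega m)))) \<le> ln (real q)"
      using prime_power(5) prime_gt_0_nat[OF prime_nth_prime[of "Suc (omega m)"]] by simp
    moreover have "ln (real (Suc (omega m))) ^ Suc (omega m)
        \<le> ln (real (nth_prime (Suc (omega m)))) * ln (real (omega m)) ^ omega m"
      by (rule ln_Suc_power_le_ln_nth_prime[OF True])
    moreover have "ln (real (omega m)) ^ omega m \<ge> 0" using True by simp
    ultimately have "ln (real (Suc (omega m))) ^ Suc (omega m) \<le> ln (real q) * ln (real (omega m)) ^ omega m"
      by (meson mult_right_mono order_trans)
    then have "log_plus (real (Suc (omega m))) ^ Suc (omega m) \<le> ln (real q) * log_plus (real (omega m)) ^ omega m"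
      using True by (simp add: log_plus_ge_2)
    with True prime_power show ?thesis by (intro divisor_bound_prime_power_mult) auto
  next
    case False
    with prime_power.prems om have "omega (q ^ a * m) = 17" by simp
    moreover have "q ^ a * m > 0" using prime_power prime_gt_0_nat[of q] by simp
    ultimately show ?thesis by (rule divisor_bound_omega_17)
  qed
qed (simp add: omega_1[simplified])

theorem theorem2:
  shows "24 * (\<Prod>i=1..16. nth_prime i) = 782139803452561073520 \<and>
    (\<forall>n::nat. n > 24 * (\<Prod>i=1..16. nth_prime i) \<longrightarrow>
       real (num_divisors n) \<le>
         (2 * ln (real n) / (real (omega n) * log_plus (real (omega n)))) ^ omega n) \<and>
    (\<forall>n::nat. n \<ge> 2 \<and> omega n \<le> 3 \<longrightarrow>
       real (num_divisors n) \<le>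
         (2 * ln (real n) / (real (omega n) * log_plus (real (omega n)))) ^ omega n)"
proof -
  have N: "24 * (\<Prod>i=1..16. nth_prime i) = 782139803452561073520"
    using primorial_16 by (simp only: primorial_def[symmetric])
  have "divisor_bound n" if "n > 782139803452561073520" for n
  proof -
    have "n > 0" using that by simp
    have "omega n \<le> 2 \<or> omega n = 3 \<or> omega n = 4 \<or> omega n = 5 \<or> omega n = 6 \<or> omega n = 7 \<or>
        omega n = 8 \<or> omega n = 9 \<or> omega n = 10 \<or> omega n = 11 \<or> omega n = 12 \<or>
        omega n = 13 \<or> omega n = 14 \<or> omega n = 15 \<or> omega n = 16 \<or> omega n \<ge> 17" by arith
    then show ?thesis
      using that \<open>n > 0\<close>
      by (elim disjE) (simp_all add: divisor_bound_omega_le_2 divisor_bound_omega_3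
          divisor_bound_omega_4 divisor_bound_omega_5 divisor_bound_omega_6 divisor_bound_omega_7
          divisor_bound_omega_8 divisor_bound_omega_9 divisor_bound_omega_10 divisor_bound_omega_11
          divisor_bound_omega_12 divisor_bound_omega_13 divisor_bound_omega_14
          divisor_bound_omega_15 divisor_bound_omega_16 divisor_bound_omega_ge_17)
  qed
  moreover have "divisor_bound n" if "n \<ge> 2" "omega n \<le> 3" for n
  proof (cases "omega n = 3")
    case True
    with that show ?thesis by (intro divisor_bound_omega_3) auto
  next
    case False
    with that show ?thesis by (intro divisor_bound_omega_le_2) auto
  qed
  ultimately show ?thesis unfolding N divisor_bound_def by simp
qed

end
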